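(* Let $t,n$ be integers with $2\leq t<n/2$ and let $A\subseteq\{0,1\}^n$ be a Steiner system with parameters $(n,t+1,t)$. Then there exists a monotone Boolean network $f:\{0,1\}^n\to\{0,1\}^n$ with $i(f)=t$, whose interaction graph $G(f)$ is the complete digraph $K_n$ without loops, and whose set of fixed points contains $A$.
   Context: A set $A=\{x^1,\dots,x^m\}\subseteq\{0,1\}^n$ is a Steiner system with parameters $(n,q,t)$ if every $x^i$ has exactly $q$ ones and for every $I=\{i_1,\dots,i_t\}\subseteq[n]$ there is a unique $x^j\in A$ with $x^j_{i_\ell}=1$ for all $\ell$. A Boolean network is $f=(f_1,\dots,f_n):\{0,1\}^n\to\{0,1\}^n$; it is monotone if $x\le y$ (coordinatewise) implies $f(x)\le f(y)$. Its interaction graph $G(f)$ is the digraph on $[n]$ with arc $(i,j)$ iff $f_j$ depends on variable $i$ (flipping $x_i$ changes $f_j(x)$ for some $x$); $K_n$ denotes the digraph with all arcs $(i,j)$, $i\ne j$. Fixed points are $x$ with $f(x)=x$. $f$ is $k$-independent if for every $I=\{i_1,\dots,i_k\}\subseteq[n]$ of size $k$ and every $a\in\{0,1\}^k$ there is a fixed point $x$ with $(x_{i_1},\dots,x_{i_k})=a$; $i(f)$ is the maximum such $k$. *)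

theory Defs
  imports "HOL-Library.Cardinality"
begin

text \<open>The index set \<open>[n]\<close> is a type \<open>'n\<close> of class \<^class>\<open>finite\<close>, with \<open>n = CARD('n)\<close>, and
  \<open>{0,1}\<^sup>n\<close> is the type \<open>'n \<Rightarrow> bool\<close>, whose library order is the coordinatewise one
  (\<open>False < True\<close>); monotone networks are thus those satisfying \<^const>\<open>mono\<close>.\<close>

type_synonym 'n config = "'n \<Rightarrow> bool"

type_synonym 'n network = "'n config \<Rightarrow> 'n config"

definition steiner_system :: "nat \<Rightarrow> nat \<Rightarrow> ('n::finite) config set \<Rightarrow> bool" where
  "steiner_system q t A \<longleftrightarrow>
     (\<forall>x\<in>A. card {i. x i} = q) \<and>
     (\<forall>I. card I = t \<longrightarrow> (\<exists>!x. x \<in> A \<and> (\<forall>i\<in>I. x i)))"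

definition fixed_points :: "('n::finite) network \<Rightarrow> 'n config set" where
  "fixed_points f = {x. f x = x}"

text \<open>Digraphs on \<open>[n]\<close> (loops allowed, no parallel arcs) are given by their arc sets.\<close>

definition interaction_graph :: "('n::finite) network \<Rightarrow> ('n \<times> 'n) set" where
  "interaction_graph f = {(i, j). \<exists>x. f (x(i := \<not> x i)) j \<noteq> f x j}"

definition complete_loopless_digraph :: "('n::finite \<times> 'n) set" where
  "complete_loopless_digraph = {(i, j). i \<noteq> j}"

text \<open>Only the values of \<open>a\<close> on \<open>I\<close> matter, so \<open>a\<close> ranges over \<open>{0,1}\<^sup>k\<close>.\<close>

definition k_independent :: "nat \<Rightarrow> ('n::finite) network \<Rightarrow> bool" where
  "k_independent k f \<longleftrightarrow>
     (\<forall>I. card I = k \<longrightarrow> (\<forall>a :: 'n config. \<exists>x\<in>fixed_points f. \<forall>i\<in>I. x i = a i))"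

text \<open>The bound \<open>k \<le> n\<close> is needed because \<open>k\<close>-independence is vacuous for \<open>k > n\<close>. The set is
  nonempty iff \<open>f\<close> has a fixed point; this is always so for monotone \<open>f\<close>.\<close>

definition independence_number :: "('n::finite) network \<Rightarrow> nat" where
  "independence_number f = Max {k. k \<le> CARD('n) \<and> k_independent k f}"

end

theory Submission
  imports Defs
begin

text \<open>Let \<open>f\<^sub>i(x) = 1\<close> iff some block contains \<open>i\<close> and has all its other points in \<open>x\<close>. Since two
  distinct blocks never share \<open>t\<close> points, every block is a fixed point. A fixed point containing
  all points of a block but one contains the block, so \<open>f\<close> is not \<open>k\<close>-independent for \<open>k > t\<close>.
  For \<open>t\<close>-independence the blocks themselves suffice: if \<open>P\<close> and \<open>Q\<close> are disjoint with
  \<open>p + q \<le> t\<close> points, the number of blocks containing \<open>P\<close> and avoiding \<open>Q\<close> is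
  \<open>(n - p - q choose t + 1 - p) / (n - t)\<close>, which is positive because \<open>2 t < n\<close>.\<close>

definition blocks_through :: "('n::finite) config set \<Rightarrow> 'n set \<Rightarrow> 'n set \<Rightarrow> 'n config set" where
  "blocks_through A P Q = {x \<in> A. (\<forall>i\<in>P. x i) \<and> (\<forall>i\<in>Q. \<not> x i)}"

definition steiner_network :: "('n::finite) config set \<Rightarrow> 'n network" where
  "steiner_network A x i \<longleftrightarrow> (\<exists>b\<in>A. b i \<and> (\<forall>j. b j \<and> j \<noteq> i \<longrightarrow> x j))"

lemma steiner_block_unique:
  assumes "steiner_system q t A" "x \<in> A" "y \<in> A" "card I = t" "\<forall>i\<in>I. x i" "\<forall>i\<in>I. y i"
  shows "x = y"
  using assms unfolding steiner_system_def by blast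

lemma steiner_block_exists:
  fixes A :: "('n::finite) config set"
  assumes "steiner_system q t A" "card I \<le> t" "t \<le> CARD('n)"
  obtains x where "x \<in> A" "\<forall>i\<in>I. x i"
proof -
  obtain J where "I \<subseteq> J" "card J = t"
    using exists_subset_between[of I t UNIV] assms(2,3) by auto
  moreover obtain x where "x \<in> A" "\<forall>i\<in>J. x i"
    using assms(1) \<open>card J = t\<close> unfolding steiner_system_def by blast
  ultimately show thesis using that by blast
qed

text \<open>Adding a point to \<open>P\<close> lowers \<open>t - card P\<close>, so the induction
  starts from \<open>t\<close>-sets, where the Steiner property gives exactly one block. The
  positive factor \<open>CARD('n) - t\<close> clears the denominator of the block count, so no
  division in nat occurs.\<close>

lemma card_blocks_containing:
  fixes A :: "('n::finite) config set"
  assumes S: "steiner_system (t + 1) t A" and "t < CARD('n)" and "card P \<le> t"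
  shows "card (blocks_through A P {}) * (CARD('n) - t) =
    (CARD('n) - card P) choose (t + 1 - card P)"
  using assms(3)
proof (induction "t - card P" arbitrary: P)
  case 0
  then have "card P = t" by simp
  then have "\<exists>!x. x \<in> A \<and> (\<forall>i\<in>P. x i)"
    using S unfolding steiner_system_def by blast
  then obtain x where "blocks_through A P {} = {x}"
    unfolding blocks_through_def by auto
  then show ?case using \<open>card P = t\<close> by simp
next
  case (Suc d)
  define n where "n = CARD('n)"
  define s where "s = card P"
  have s: "s < t" "t < n" using Suc.hyps Suc.prems assms(2) unfolding n_def s_def by auto
  define B where "B = blocks_through A P {}"
  \<comment> \<open>Double counting of the pairs of a block through \<open>P\<close> and a point of it outside \<open>P\<close>.\<close>
  have "(\<Sum>z\<in>-P. card {x\<in>B. x z}) = (\<Sum>x\<in>B. card {z\<in>-P. x z})"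
    using sum.swap_restrict[of "-P" B "\<lambda>_ _. 1::nat" "\<lambda>z x. x z"] by simp
  also have "\<dots> = (\<Sum>x\<in>B. t + 1 - s)"
  proof (rule sum.cong[OF refl])
    fix x assume "x \<in> B"
    then have "card {i. x i} = t + 1" "P \<subseteq> {i. x i}"
      using S unfolding B_def blocks_through_def steiner_system_def by auto
    moreover have "{z\<in>-P. x z} = {i. x i} - P" by auto
    ultimately show "card {z\<in>-P. x z} = t + 1 - s"
      by (simp add: card_Diff_subset s_def)
  qed
  finally have count: "(\<Sum>z\<in>-P. card {x\<in>B. x z}) = card B * (t + 1 - s)" by simp
  have "card {x\<in>B. x z} * (n - t) = (n - Suc s) choose (t - s)" if "z \<in> -P" for z
  proof -
    have c: "card (insert z P) = Suc s" using that by (simp add: s_def)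
    have "{x\<in>B. x z} = blocks_through A (insert z P) {}"
      unfolding B_def blocks_through_def by auto
    moreover have "d = t - card (insert z P)" using Suc.hyps(2) c s_def by simp
    ultimately show ?thesis
      using Suc.hyps(1)[of "insert z P"] c s by (simp add: n_def)
  qed
  then have "(\<Sum>z\<in>-P. card {x\<in>B. x z} * (n - t)) = (n - s) * ((n - Suc s) choose (t - s))"
    by (simp add: s_def n_def Compl_eq_Diff_UNIV card_Diff_subset)
  then have "card B * (n - t) * (t + 1 - s) = (n - s) * ((n - Suc s) choose (t - s))"
    by (simp add: sum_distrib_right[symmetric] count mult.assoc mult.commute[of "n - t"])
  \<comment> \<open>Absorption identity for binomials. The factor \<open>t + 1 - s\<close> is
    positive and cancels at the end.\<close>
  also have "\<dots> = ((n - s) choose (t + 1 - s)) * (t + 1 - s)"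
    using Suc_times_binomial_eq[of "n - Suc s" "t - s"] s by (simp add: Suc_diff_Suc Suc_diff_le)
  finally show ?case using s unfolding B_def n_def s_def by simp
qed

text \<open>Induction on \<open>Q\<close>: the blocks through \<open>P\<close> that avoid
  \<open>Q\<close> either avoid a new point \<open>z\<close> or contain it, and subtracting the
  latter is Pascal's rule. \<open>P\<close> is kept arbitrary because \<open>z\<close> moves into
  it, which respects the bound \<open>t\<close> on the total size.\<close>

lemma card_blocks_through:
  fixes A :: "('n::finite) config set"
  assumes S: "steiner_system (t + 1) t A" and "t < CARD('n)"
    and "P \<inter> Q = {}" "card P + card Q \<le> t"
  shows "card (blocks_through A P Q) * (CARD('n) - t) =
    (CARD('n) - card P - card Q) choose (t + 1 - card P)"
proof -
  have "finite Q" by simp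
  then show ?thesis using assms(3,4)
  proof (induction Q arbitrary: P rule: finite_induct)
    case empty
    then show ?case using card_blocks_containing[OF assms(1,2)] by simp
  next
    case (insert z Q)
    define m where "m = CARD('n) - card P - card Q"
    define k where "k = t + 1 - card P"
    define r where "r = CARD('n) - t"
    have "blocks_through A P Q =
        blocks_through A P (insert z Q) \<union> blocks_through A (insert z P) Q"
      "blocks_through A P (insert z Q) \<inter> blocks_through A (insert z P) Q = {}"
      unfolding blocks_through_def by auto
    then have split: "card (blocks_through A P Q) =
        card (blocks_through A P (insert z Q)) + card (blocks_through A (insert z P) Q)"
      by (simp add: card_Un_disjoint)
    have 1: "card (blocks_through A P Q) * r = m choose k"
      using insert.IH[of P] insert.prems insert.hyps by (simp add: m_def k_def r_def)
    have 2: "card (blocks_through A (insert z P) Q) * r = (m - 1) choose (k - 1)"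
      using insert.IH[of "insert z P"] insert.prems insert.hyps
      by (simp add: m_def k_def r_def)
    have "0 < m" "0 < k" using insert.prems insert.hyps assms(2) by (auto simp: m_def k_def)
    then have "m choose k = ((m - 1) choose (k - 1)) + ((m - 1) choose k)"
      by (rule choose_reduce_nat)
    then have "card (blocks_through A P (insert z Q)) * r = (m - 1) choose k"
      using 1 2 split by (simp add: add_mult_distrib)
    then show ?case using insert.hyps by (simp add: m_def k_def r_def)
  qed
qed

lemma mono_steiner_network:
  fixes A :: "('n::finite) config set"
  shows "mono (steiner_network A)"
proof (intro monoI le_funI le_boolI)
  fix x y :: "'n config" and i
  assume "x \<le> y" "steiner_network A x i"
  then obtain b where "b \<in> A" "b i" "\<forall>j. b j \<and> j \<noteq> i \<longrightarrow> x j"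
    unfolding steiner_network_def by blast
  moreover from this \<open>x \<le> y\<close> have "\<forall>j. b j \<and> j \<noteq> i \<longrightarrow> y j"
    by (auto dest: le_funD)
  ultimately show "steiner_network A y i"
    unfolding steiner_network_def by (intro bexI[of _ b]) auto
qed

lemma blocks_subset_fixed_points:
  assumes S: "steiner_system (t + 1) t A"
  shows "A \<subseteq> fixed_points (steiner_network A)"
proof
  fix b assume b: "b \<in> A"
  have "steiner_network A b i = b i" for i
  proof
    assume "steiner_network A b i"
    then obtain c where c: "c \<in> A" "c i" "\<forall>j. c j \<and> j \<noteq> i \<longrightarrow> b j"
      unfolding steiner_network_def by blast
    have "card {j. c j} = t + 1" using S c(1) unfolding steiner_system_def by blast
    then have "card ({j. c j} - {i}) = t" using c(2) by simp
    \<comment> \<open>The \<open>t\<close> points of \<open>c\<close> other than \<open>i\<close>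
      also lie in \<open>b\<close>.\<close>
    then have "c = b"
      using steiner_block_unique[OF S c(1) b] c(3) by auto
    then show "b i" using c(2) by simp
  qed (use b in \<open>auto simp: steiner_network_def\<close>)
  then show "b \<in> fixed_points (steiner_network A)" unfolding fixed_points_def by auto
qed

text \<open>As 2 \<le> t, any two points \<open>i\<close>, \<open>j\<close> lie in a common block
  \<open>b\<close>. At \<open>b\<close> without \<open>i\<close> and \<open>j\<close>, switching
  \<open>i\<close> on completes all of \<open>b\<close> but \<open>j\<close>, which activates
  \<open>j\<close>.\<close>

lemma interaction_graph_steiner_network:
  fixes A :: "('n::finite) config set"
  assumes S: "steiner_system (t + 1) t A" and "2 \<le> t" "t \<le> CARD('n)"
  shows "interaction_graph (steiner_network A) = complete_loopless_digraph"
proof -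
  have "\<exists>x. steiner_network A (x(i := \<not> x i)) j \<noteq> steiner_network A x j" if "i \<noteq> j" for i j
  proof -
    have "card {i, j} \<le> t" using that assms(2) by simp
    from S this assms(3) obtain b where "b \<in> A" "\<forall>k\<in>{i, j}. b k"
      by (rule steiner_block_exists)
    then have b: "b \<in> A" "b i" "b j" by simp_all
    define x where "x k \<longleftrightarrow> b k \<and> k \<noteq> i \<and> k \<noteq> j" for k
    have weight: "card {k. c k} = t + 1" if "c \<in> A" for c
      using S that unfolding steiner_system_def by blast
    have "steiner_network A (x(i := \<not> x i)) j"
      unfolding steiner_network_def using b by (intro bexI[of _ b]) (auto simp: x_def)
    moreover have "\<not> steiner_network A x j"
    proof
      assume "steiner_network A x j"
      then obtain c where c: "c \<in> A" "c j" "\<forall>k. c k \<and> k \<noteq> j \<longrightarrow> x k"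
        unfolding steiner_network_def by blast
      \<comment> \<open>With \<open>i\<close> off, a block activating \<open>j\<close> would fit
        into \<open>b\<close> minus a point, but all blocks have the same size.\<close>
      have "{k. c k} \<subseteq> {k. b k} - {i}" using c b that by (auto simp: x_def)
      then have "card {k. c k} \<le> card ({k. b k} - {i})" by (intro card_mono) auto
      then show False using weight[OF c(1)] weight[OF b(1)] b(2) by simp
    qed
    ultimately show ?thesis by blast
  qed
  \<comment> \<open>No loops: the condition for \<open>i\<close> never reads the value of
    \<open>x\<close> at \<open>i\<close>.\<close>
  moreover have "steiner_network A (x(i := v)) i = steiner_network A x i" for x v i
    unfolding steiner_network_def by auto
  ultimately show ?thesis
    unfolding interaction_graph_def complete_loopless_digraph_def by blast
qed

lemma k_independent_steiner_network:
  fixes A :: "('n::finite) config set"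
  assumes S: "steiner_system (t + 1) t A" and "2 * t < CARD('n)"
  shows "k_independent t (steiner_network A)"
  unfolding k_independent_def
proof (intro allI impI)
  fix I :: "'n set" and a :: "'n config"
  assume I: "card I = t"
  define P where "P = {i\<in>I. a i}"
  define Q where "Q = {i\<in>I. \<not> a i}"
  have "P \<inter> Q = {}" "P \<union> Q = I" by (auto simp: P_def Q_def)
  then have "card P + card Q = t" using I card_Un_disjoint[of P Q] by simp
  then have "card (blocks_through A P Q) * (CARD('n) - t) =
      (CARD('n) - card P - card Q) choose (t + 1 - card P)"
    using card_blocks_through[OF S _ \<open>P \<inter> Q = {}\<close>] assms(2) by simp
  \<comment> \<open>The lower index is \<open>card Q + 1\<close>, at most \<open>t + 1\<close>, and
    the upper one is \<open>CARD('n) - t\<close>, which is at least \<open>t + 1\<close> because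
    \<open>2 * t < CARD('n)\<close>.\<close>
  also have "\<dots> > 0" using assms(2) \<open>card P + card Q = t\<close> by simp
  finally have "blocks_through A P Q \<noteq> {}" by auto
  then obtain x where "x \<in> A" "\<forall>i\<in>P. x i" "\<forall>i\<in>Q. \<not> x i"
    unfolding blocks_through_def by blast
  then show "\<exists>x\<in>fixed_points (steiner_network A). \<forall>i\<in>I. x i = a i"
    using blocks_subset_fixed_points[OF S] by (intro bexI[of _ x]) (auto simp: P_def Q_def)
qed

lemma not_k_independent_steiner_network:
  fixes A :: "('n::finite) config set"
  assumes S: "steiner_system (t + 1) t A" and "t < k" "k \<le> CARD('n)"
  shows "\<not> k_independent k (steiner_network A)"
proof
  assume ind: "k_independent k (steiner_network A)"
  obtain b where b: "b \<in> A"
    using steiner_block_exists[OF S, of "{}"] assms(2,3) by auto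
  have weight: "card {i. b i} = t + 1" using S b unfolding steiner_system_def by blast
  then obtain i where i: "b i" by fastforce
  obtain I where I: "{i. b i} \<subseteq> I" "card I = k"
    using exists_subset_between[of "{i. b i}" k UNIV] weight assms(2,3) by auto
  have "\<exists>x\<in>fixed_points (steiner_network A). \<forall>j\<in>I. x j = a j" for a
    using ind I(2) unfolding k_independent_def by simp
  \<comment> \<open>The unattainable pattern: 1 on all of \<open>I\<close> except at the point
    \<open>i\<close> of \<open>b\<close>. The rest of \<open>b\<close> then forces the value 1 at
    \<open>i\<close>.\<close>
  from this[of "\<lambda>j. j \<noteq> i"]
  obtain x where x: "steiner_network A x = x" "\<forall>j\<in>I. x j = (j \<noteq> i)"
    unfolding fixed_points_def by auto
  have "steiner_network A x i"
    unfolding steiner_network_def using b i x(2) I(1) by (intro bexI[of _ b]) auto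
  then show False using x i I(1) by auto
qed

theorem theorem3p3:
  fixes t :: nat and A :: "('n::finite) config set"
  assumes "2 \<le> t" and "2 * t < CARD('n)"
    and "steiner_system (t + 1) t A"
  shows "\<exists>f :: 'n network.
    mono f \<and>
    independence_number f = t \<and>
    interaction_graph f = complete_loopless_digraph \<and>
    A \<subseteq> fixed_points f"
proof (intro exI conjI)
  show "independence_number (steiner_network A) = t"
    unfolding independence_number_def
  proof (rule Max_eqI)
    show "k \<le> t" if "k \<in> {k. k \<le> CARD('n) \<and> k_independent k (steiner_network A)}" for k
      using that not_k_independent_steiner_network[OF assms(3)] by (auto simp: not_less[symmetric])
  qed (use assms k_independent_steiner_network[OF assms(3,2)] in auto)
  show "interaction_graph (steiner_network A) = complete_loopless_digraph"
    using interaction_graph_steiner_network[OF assms(3,1)] assms(2) by simp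
qed (rule mono_steiner_network blocks_subset_fixed_points[OF assms(3)])+

end
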